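(* Let $a,b,c,d\in\mathbb{R}$. Then the Matkowski--Sut\^o equation \[ S_{a,b}(x,y)+S_{c,d}(x,y)=x+y\qquad\text{for all }x,y\in\mathbb{R}_+ \] holds if and only if $\{a,b\}=\{c,d\}=\{2,1\}$, i.e., both means are equal to the arithmetic mean.
   Context: $\mathbb{R}_+$ denotes the set of positive real numbers. For $p,q\in\mathbb{R}$, the two-variable Stolarsky mean $S_{p,q}:\mathbb{R}_+^2\to\mathbb{R}_+$ is defined as follows. If $x=y$, then $S_{p,q}(x,y)=x$. If $x\neq y$, then \[ S_{p,q}(x,y)=\begin{cases} \left(\dfrac{q(x^p-y^p)}{p(x^q-y^q)}\right)^{\frac1{p-q}} & \text{if } (p-q)pq\neq 0,\\[3mm] \exp\left(-\dfrac1p+\dfrac{x^p\log x-y^p\log y}{x^p-y^p}\right) & \text{if } p=q\neq 0,\\[3mm] \left(\dfrac{x^p-y^p}{p(\log x-\log y)}\right)^{\frac1p} & \text{if } p\neq 0,\ q=0,\\[3mm] \left(\dfrac{q(\log x-\log y)}{x^q-y^q}\right)^{-\frac1q} & \text{if } p=0,\ q\neq 0,\\[3mm] \sqrt{xy} & \text{if } p=q=0. \end{cases} \] Equalities such as $\{a,b\}=\{c,d\}$ are equalities of (unordered) sets. *)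

theory Defs
  imports Complex_Main
begin

text \<open>
  The two-variable Stolarsky mean with real parameters \<open>p\<close>, \<open>q\<close>. It is meaningful for
  positive arguments only; the values at other arguments are irrelevant. For \<open>x > 0\<close>, \<open>y > 0\<close>,
  \<open>x \<noteq> y\<close>, every denominator is nonzero and every base of an outer \<open>powr\<close> is positive.
\<close>

definition stolarsky :: "real \<Rightarrow> real \<Rightarrow> real \<Rightarrow> real \<Rightarrow> real" where
  "stolarsky p q x y =
    (if x = y then x
     else if (p - q) * p * q \<noteq> 0 then
       ((q * (x powr p - y powr p)) / (p * (x powr q - y powr q))) powr (1 / (p - q))
     else if p = q \<and> p \<noteq> 0 then
       exp (- (1 / p) + (x powr p * ln x - y powr p * ln y) / (x powr p - y powr p))
     else if p \<noteq> 0 \<and> q = 0 then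
       ((x powr p - y powr p) / (p * (ln x - ln y))) powr (1 / p)
     else if p = 0 \<and> q \<noteq> 0 then
       ((q * (ln x - ln y)) / (x powr q - y powr q)) powr (- (1 / q))
     else sqrt (x * y))"

end

theory Submission
  imports Defs "HOL-Real_Asymp.Real_Asymp"
begin

text \<open>
  By homogeneity everything is visible at \<open>x = 1\<close>, and the behaviour as \<open>y \<rightarrow> 0\<close> alone
  determines the parameters. Let \<open>a \<ge> b\<close> and \<open>c \<ge> d\<close>. The mean \<open>S\<^bsub>a,b\<^esub>(1, y)\<close> tends to
  \<open>e = (b/a)\<^bsup>1/(a-b)\<^esup> < 1\<close> if \<open>b > 0\<close> and to \<open>0\<close> otherwise, so a limit sum of \<open>1\<close> forces all
  four parameters to be positive. Then
  \<open>S\<^bsub>a,b\<^esub>(1, y) = e + e/(a-b) y\<^bsup>b\<^esup> - e/(a-b) y\<^bsup>a\<^esup> + O(y\<^bsup>2b\<^esup>)\<close> if \<open>a \<noteq> b\<close>, with a term in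
  \<open>y\<^bsup>b\<^esup> ln y\<close> if \<open>a = b\<close>. Comparing the sum with \<open>1 + y\<close> shows that the smaller of \<open>b\<close>, \<open>d\<close> is \<open>1\<close>.

  If \<open>b = d = 1\<close>, an exponent \<open>a < 2\<close> or \<open>c < 2\<close> would leave a negative term uncancelled; so
  \<open>a, c \<ge> 2\<close>, and \<open>e\<^sub>1 + e\<^sub>2 = 1 = e\<^sub>1/(a-1) + e\<^sub>2/(c-1)\<close> gives \<open>a = c = 2\<close>. If \<open>b = 1 < d\<close>,
  put \<open>r = a - 1\<close>. The coefficient of \<open>y\<close> gives \<open>e\<^sub>1 = r\<close>, the cancellation at \<open>y\<^bsup>a\<^esup>\<close> gives \<open>d = a\<close> and
  \<open>e\<^sub>2 = c - a\<close>, and so \<open>c = 2\<close>. The formulas for \<open>e\<^sub>1\<close> and \<open>e\<^sub>2\<close> now read \<open>r\<^bsup>r\<^esup> = 1/(1+r)\<close> and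
  \<open>(1-r)\<^bsup>1-r\<^esup> = (1+r)/2\<close>. Their product says that \<open>r\<close> has binary entropy \<open>ln 2\<close>, whence
  \<open>r = 1/2\<close>, which does not satisfy either equation.
\<close>

section \<open>Symmetry in the parameters, the arithmetic mean and the limit constant\<close>

lemma stolarsky_commute:
  "stolarsky p q x y = stolarsky q p x y"
proof (cases "x = y \<or> p = q \<or> p = 0 \<or> q = 0")
  case True
  \<comment> \<open>Exchanging a zero and a nonzero parameter inverts the base and negates the outer
    exponent.\<close>
  have *: "u powr (1 / p) = inverse u powr (- (1 / p))" for u p :: real
    by (simp add: powr_def ln_inverse)
  show ?thesis
    using True by (auto simp: stolarsky_def * )
next
  case False
  define u where "u = q * (x powr p - y powr p) / (p * (x powr q - y powr q))"
  have "stolarsky p q x y = u powr (1 / (p - q))"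
    using False by (simp add: stolarsky_def u_def)
  also have "\<dots> = inverse u powr (1 / (q - p))"
    by (simp add: powr_def ln_inverse minus_divide_right)
  also have "\<dots> = stolarsky q p x y"
    using False by (simp add: stolarsky_def u_def)
  finally show ?thesis .
qed

lemma stolarsky_max_min: "stolarsky (max p q) (min p q) x y = stolarsky p q x y"
  by (simp add: max_def min_def stolarsky_commute)

lemma stolarsky_2_1:
  assumes "x > 0" "y > 0"
  shows "stolarsky 2 1 x y = (x + y) / 2"
proof (cases "x = y")
  case False
  have "(x powr 2 - y powr 2) / (2 * (x powr 1 - y powr 1)) = (x + y) / 2"
    using assms False by (simp add: field_simps power2_eq_square)
  moreover have "stolarsky 2 1 x y = ((x powr 2 - y powr 2) / (2 * (x powr 1 - y powr 1))) powr 1"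
    using False by (simp add: stolarsky_def del: powr_one powr_numeral)
  ultimately have "stolarsky 2 1 x y = ((x + y) / 2) powr 1"
    by (simp only:)
  then show ?thesis
    using assms by simp
qed (simp add: stolarsky_def)

text \<open>For positive parameters the diagonal value is the limit of the other formula as
  \<open>p\<close> tends to \<open>q\<close>.\<close>

definition stolarsky_lim :: "real \<Rightarrow> real \<Rightarrow> real" where
  "stolarsky_lim p q = (if p = q then exp (- (1 / p)) else (q / p) powr (1 / (p - q)))"

lemma stolarsky_lim_pos: "0 < p \<Longrightarrow> 0 < q \<Longrightarrow> stolarsky_lim p q > 0"
  by (simp add: stolarsky_lim_def)

lemma stolarsky_lim_less_1:
  assumes "0 < q" "q \<le> p"
  shows "stolarsky_lim p q < 1"
proof (cases "p = q")
  case False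
  then show ?thesis
    using assms powr_less_mono2[of "1 / (p - q)" "q / p" 1] by (simp add: stolarsky_lim_def)
qed (use assms in \<open>simp add: stolarsky_lim_def\<close>)

section \<open>Expansions at (1, y) as y tends to 0, for positive parameters\<close>

lemma eventually_0_1: "\<forall>\<^sub>F y::real in at_right 0. 0 < y \<and> y < 1"
  using eventually_at_right_real[of 0 1] by simp

lemma stolarsky_1_eq:
  assumes "0 < y" "y < 1" "0 < q" "q < p"
  shows "stolarsky p q 1 y
    = stolarsky_lim p q * ((1 - y powr p) / (1 - y powr q)) powr (1 / (p - q))"
proof -
  have "0 < 1 - y powr p" "0 < 1 - y powr q"
    using assms powr_less_mono2[of p y 1] powr_less_mono2[of q y 1] by auto
  then show ?thesis
    using assms by (simp add: stolarsky_def stolarsky_lim_def flip: powr_mult)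
qed

lemma stolarsky_1_eq_diag:
  assumes "0 < y" "y < 1" "q \<noteq> 0"
  shows "stolarsky q q 1 y = exp (- (1 / q) - y powr q * ln y / (1 - y powr q))"
  using assms by (simp add: stolarsky_def)

lemma tendsto_divide_powr_smaller:
  fixes f :: "real \<Rightarrow> real"
  assumes "((\<lambda>y. f y / y powr q) \<longlongrightarrow> L) (at_right 0)" "s < q"
  shows "((\<lambda>y. f y / y powr s) \<longlongrightarrow> 0) (at_right 0)"
proof -
  have "((\<lambda>y::real. y powr (q - s)) \<longlongrightarrow> 0) (at_right 0)"
    using assms(2) by real_asymp
  from tendsto_mult[OF assms(1) this]
  have "((\<lambda>y. f y / y powr q * y powr (q - s)) \<longlongrightarrow> 0) (at_right 0)"
    by simp
  then show ?thesis
    by (rule Lim_transform_eventually)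
      (use eventually_0_1 in eventually_elim, simp add: powr_diff)
qed

text \<open>Since \<open>q < p\<close>, the quotient of \<open>1 - y powr p\<close> by
  \<open>1 - y powr q\<close> is 1 + y^q + o(y^q); the outer exponent divides the coefficient by
  \<open>p - q\<close>.\<close>

lemma stolarsky_expand1:
  assumes "0 < q" "q < p"
  shows "((\<lambda>y. (stolarsky p q 1 y - stolarsky_lim p q) / y powr q)
           \<longlongrightarrow> stolarsky_lim p q / (p - q)) (at_right 0)"
proof -
  have "((\<lambda>y::real. (((1 - y powr p) / (1 - y powr q)) powr (1 / (p - q)) - 1) / y powr q)
          \<longlongrightarrow> 1 / (p - q)) (at_right 0)"
    using assms by real_asymp
  from tendsto_mult_left[OF this, of "stolarsky_lim p q"]
  have "((\<lambda>y::real. stolarsky_lim p q *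
            ((((1 - y powr p) / (1 - y powr q)) powr (1 / (p - q)) - 1) / y powr q))
          \<longlongrightarrow> stolarsky_lim p q / (p - q)) (at_right 0)"
    by simp
  then show ?thesis
    by (rule Lim_transform_eventually)
      (use eventually_0_1 in eventually_elim, use assms in \<open>simp add: stolarsky_1_eq field_simps\<close>)
qed

text \<open>On the diagonal the exponent gains the positive term \<open>- y powr q * ln y\<close> to
  leading order, which outgrows \<open>y powr q\<close> by a logarithm.\<close>

lemma stolarsky_expand1_diag:
  assumes "0 < q"
  shows "filterlim (\<lambda>y. (stolarsky q q 1 y - stolarsky_lim q q) / y powr q) at_top (at_right 0)"
proof -
  have "filterlim (\<lambda>y::real. (exp (- (1 / q) - y powr q * ln y / (1 - y powr q)) - exp (- (1 / q)))
           / y powr q) at_top (at_right 0)"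
    using assms by real_asymp
  also have "?this \<longleftrightarrow> ?thesis"
    by (rule filterlim_cong[OF refl refl], use eventually_0_1 in eventually_elim)
      (use assms in \<open>simp add: stolarsky_1_eq_diag stolarsky_lim_def\<close>)
  finally show ?thesis .
qed

lemma stolarsky_expand0:
  assumes "0 < s" "s < q" "q \<le> p"
  shows "((\<lambda>y. (stolarsky p q 1 y - stolarsky_lim p q) / y powr s) \<longlongrightarrow> 0) (at_right 0)"
proof (cases "q = p")
  case False
  with assms have "0 < q" "q < p" by auto
  from tendsto_divide_powr_smaller[OF stolarsky_expand1[OF this] \<open>s < q\<close>] show ?thesis .
next
  case [simp]: True
  have "((\<lambda>y::real. (exp (- (1 / q) - y powr q * ln y / (1 - y powr q)) - exp (- (1 / q)))
           / y powr s) \<longlongrightarrow> 0) (at_right 0)"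
    using assms by real_asymp
  then show ?thesis
    by (rule Lim_transform_eventually)
      (use eventually_0_1 in eventually_elim,
       use assms in \<open>simp add: stolarsky_1_eq_diag stolarsky_lim_def\<close>)
qed

lemma stolarsky_tendsto_lim:
  assumes "0 < q" "q \<le> p"
  shows "(stolarsky p q 1 \<longlongrightarrow> stolarsky_lim p q) (at_right 0)"
proof -
  have "((\<lambda>y. (stolarsky p q 1 y - stolarsky_lim p q) / y powr (q / 2)) \<longlongrightarrow> 0) (at_right 0)"
    by (rule stolarsky_expand0) (use assms in auto)
  from tendsto_divide_powr_smaller[OF this, of 0]
  have "((\<lambda>y. (stolarsky p q 1 y - stolarsky_lim p q) / y powr 0) \<longlongrightarrow> 0) (at_right 0)"
    using assms by simp
  then have "((\<lambda>y. stolarsky p q 1 y - stolarsky_lim p q) \<longlongrightarrow> 0) (at_right 0)"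
    by (rule Lim_transform_eventually) (use eventually_0_1 in eventually_elim, simp)
  then show ?thesis
    by (simp flip: LIM_zero_iff[where l = "stolarsky_lim p q"])
qed

text \<open>The quotient by \<open>y powr q\<close> converges off the diagonal and diverges on it; a
  one-sided bound serves both cases.\<close>

lemma stolarsky_ge:
  assumes "0 < q" "q \<le> p"
  obtains \<delta> where "\<delta> > 0"
    "\<forall>\<^sub>F y in at_right 0. stolarsky p q 1 y - stolarsky_lim p q \<ge> \<delta> * y powr q"
proof -
  have "\<exists>\<delta>>0. \<forall>\<^sub>F y in at_right 0. (stolarsky p q 1 y - stolarsky_lim p q) / y powr q > \<delta>"
  proof (cases "q = p")
    case True
    then show ?thesis
      using stolarsky_expand1_diag[of p] assms by (auto simp: filterlim_at_top_dense intro: exI[of _ 1])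
  next
    case False
    define L where "L = stolarsky_lim p q / (p - q)"
    have "L > 0"
      using False assms by (simp add: L_def stolarsky_lim_pos)
    then have "L / 2 > 0" "L / 2 < L"
      by auto
    moreover have "((\<lambda>y. (stolarsky p q 1 y - stolarsky_lim p q) / y powr q) \<longlongrightarrow> L) (at_right 0)"
      unfolding L_def by (rule stolarsky_expand1) (use False assms in auto)
    ultimately show ?thesis
      using order_tendstoD(1) by blast
  qed
  then obtain \<delta> where \<delta>: "\<delta> > 0"
    "\<forall>\<^sub>F y in at_right 0. (stolarsky p q 1 y - stolarsky_lim p q) / y powr q > \<delta>"
    by blast
  show thesis
    by (rule that[OF \<delta>(1)], use \<delta>(2) eventually_0_1 in eventually_elim) (simp add: field_simps)
qed

text \<open>With \<alpha> = 1/(p - 1) the power is 1 + \<alpha> y - \<alpha> y^p + O(y^2), and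
  \<open>p < 2\<close> lets y^p dominate the error.\<close>

lemma stolarsky_1_expand2:
  assumes "1 < p" "p < 2"
  shows "((\<lambda>y. (stolarsky p 1 1 y - stolarsky_lim p 1 - stolarsky_lim p 1 / (p - 1) * y) / y powr p)
           \<longlongrightarrow> - (stolarsky_lim p 1 / (p - 1))) (at_right 0)"
proof -
  have "((\<lambda>y::real. (((1 - y powr p) / (1 - y)) powr (1 / (p - 1)) - 1 - 1 / (p - 1) * y) / y powr p)
          \<longlongrightarrow> - (1 / (p - 1))) (at_right 0)"
    using assms by real_asymp
  from tendsto_mult_left[OF this, of "stolarsky_lim p 1"]
  have "((\<lambda>y::real. stolarsky_lim p 1 *
            ((((1 - y powr p) / (1 - y)) powr (1 / (p - 1)) - 1 - 1 / (p - 1) * y) / y powr p))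
          \<longlongrightarrow> - (stolarsky_lim p 1 / (p - 1))) (at_right 0)"
    by simp
  then show ?thesis
    by (rule Lim_transform_eventually)
      (use eventually_0_1 in eventually_elim, use assms in \<open>simp add: stolarsky_1_eq field_simps\<close>)
qed

lemma stolarsky_1_expand2_smaller:
  assumes "1 < p" "s < p" "s < 2"
  shows "((\<lambda>y. (stolarsky p 1 1 y - stolarsky_lim p 1 - stolarsky_lim p 1 / (p - 1) * y) / y powr s)
           \<longlongrightarrow> 0) (at_right 0)"
proof (cases "p < 2")
  case True
  from tendsto_divide_powr_smaller[OF stolarsky_1_expand2[OF \<open>1 < p\<close> this] \<open>s < p\<close>] show ?thesis .
next
  case False
  define \<alpha> where "\<alpha> = 1 / (p - 1)"
  have "\<exists>L. ((\<lambda>y::real. (((1 - y powr p) / (1 - y)) powr \<alpha> - 1 - \<alpha> * y) / y powr 2)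
          \<longlongrightarrow> L) (at_right 0)"
  proof (cases "p = 2")
    case True
    \<comment> \<open>Here \<alpha> = 1 and the quotient is exactly 1 + y.\<close>
    have "((\<lambda>y::real. (((1 - y powr p) / (1 - y)) powr \<alpha> - 1 - \<alpha> * y) / y powr 2)
          \<longlongrightarrow> 0) (at_right 0)"
      unfolding True \<alpha>_def by real_asymp
    then show ?thesis ..
  next
    case False
    with \<open>\<not> p < 2\<close> have "2 < p" "0 < \<alpha>" by (auto simp: \<alpha>_def)
    \<comment> \<open>The binomial series contributes (\<alpha> - 1) \<alpha> / 2, and the y^2 in
      1/(1 - y) contributes \<alpha>.\<close>
    then have "((\<lambda>y::real. (((1 - y powr p) / (1 - y)) powr \<alpha> - 1 - \<alpha> * y) / y powr 2)
          \<longlongrightarrow> (\<alpha> - 1) * \<alpha> / 2 + \<alpha>) (at_right 0)"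
      by real_asymp
    then show ?thesis ..
  qed
  then obtain L where "((\<lambda>y::real. (((1 - y powr p) / (1 - y)) powr \<alpha> - 1 - \<alpha> * y) / y powr 2)
          \<longlongrightarrow> L) (at_right 0)" ..
  from tendsto_mult_right_zero[OF tendsto_divide_powr_smaller[OF this \<open>s < 2\<close>], of "stolarsky_lim p 1"]
  show ?thesis
    by (rule Lim_transform_eventually)
      (use eventually_0_1 in eventually_elim,
       use assms in \<open>simp add: stolarsky_1_eq \<alpha>_def field_simps\<close>)
qed

section \<open>A nonpositive smaller parameter: limit 0\<close>

lemma stolarsky_tendsto_0:
  assumes "q \<le> p" "q \<le> 0"
  shows "(stolarsky p q 1 \<longlongrightarrow> 0) (at_right 0)"
proof -
  \<comment> \<open>The rate of decay depends on the case: only a power of 1/|ln y| for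
    \<open>0 < p\<close>, \<open>q = 0\<close>, but of order y when both parameters are
    negative.\<close>
  consider "p = 0" "q = 0" | "p = q" "q < 0" | "0 < p" "q = 0" | "p = 0" "q < 0"
    | "0 < p" "q < 0" | "q < p" "p < 0"
    using assms by linarith
  then show ?thesis
  proof cases
    case 1
    have "((\<lambda>y::real. sqrt y) \<longlongrightarrow> 0) (at_right 0)"
      by real_asymp
    then show ?thesis
      by (rule Lim_transform_eventually)
        (use eventually_0_1 in eventually_elim, simp add: 1 stolarsky_def)
  next
    case 2
    have "((\<lambda>y::real. exp (- (1 / q) - y powr q * ln y / (1 - y powr q))) \<longlongrightarrow> 0) (at_right 0)"
      using 2 by real_asymp
    then show ?thesis
      by (rule Lim_transform_eventually)
        (use eventually_0_1 in eventually_elim, use 2 in \<open>simp add: stolarsky_1_eq_diag\<close>)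
  next
    case 3
    then have "((\<lambda>y::real. ((1 - y powr p) / (p * (- ln y))) powr (1 / p)) \<longlongrightarrow> 0) (at_right 0)"
      by real_asymp
    then show ?thesis
      by (rule Lim_transform_eventually)
        (use eventually_0_1 in eventually_elim, use 3 in \<open>simp add: stolarsky_def\<close>)
  next
    case 4
    then have "((\<lambda>y::real. ((q * (- ln y)) / (1 - y powr q)) powr (- (1 / q))) \<longlongrightarrow> 0) (at_right 0)"
      by real_asymp
    then show ?thesis
      by (rule Lim_transform_eventually)
        (use eventually_0_1 in eventually_elim, use 4 in \<open>simp add: stolarsky_def\<close>)
  next
    case 5
    define r where "r = - q"
    have "0 < r"
      using 5 by (simp add: r_def)
    with \<open>0 < p\<close> have "((\<lambda>y::real. ((- r * (1 - y powr p)) / (p * (1 - y powr - r))) powr (1 / (p + r))) \<longlongrightarrow> 0)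
            (at_right 0)"
      by real_asymp
    then show ?thesis
      by (rule Lim_transform_eventually)
        (use eventually_0_1 in eventually_elim, use 5 in \<open>simp add: stolarsky_def r_def\<close>)
  next
    case 6
    define r t where "r = - q" and "t = - p"
    have rt: "0 < t" "t < r"
      using 6 by (auto simp: r_def t_def)
    \<comment> \<open>The base is asymptotic to (r/t) y^(r - t), where \<open>t < r\<close>.\<close>
    have lim: "((\<lambda>y::real. (r * (1 - y powr - t)) / (t * (1 - y powr - r))) \<longlongrightarrow> 0) (at_right 0)"
      using rt by real_asymp
    have "((\<lambda>y::real. ((r * (1 - y powr - t)) / (t * (1 - y powr - r))) powr (1 / (r - t))) \<longlongrightarrow> 0)
            (at_right 0)"
    proof (rule tendsto_zero_powrI[OF lim tendsto_const])
      show "\<forall>\<^sub>F y::real in at_right 0. 0 \<le> r * (1 - y powr - t) / (t * (1 - y powr - r))"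
        using eventually_0_1
      proof eventually_elim
        case (elim y)
        then have "y powr - t \<ge> 1" "y powr - r \<ge> 1"
          using rt powr_le1[of t y] powr_le1[of r y] by (auto simp: powr_minus one_le_inverse_iff)
        with rt show ?case
          by (intro divide_nonpos_nonpos mult_nonneg_nonpos) auto
      qed
    qed (use rt in auto)
    then show ?thesis
      by (rule Lim_transform_eventually)
        (use eventually_0_1 in eventually_elim, use 6 in \<open>simp add: stolarsky_def r_def t_def\<close>)
  qed
qed

text \<open>The last clause turns a positive limit back into a positive smaller parameter.\<close>

lemma stolarsky_tendsto_less_1:
  assumes "q \<le> p"
  obtains L where "(stolarsky p q 1 \<longlongrightarrow> L) (at_right 0)" "L < 1" "L > 0 \<longrightarrow> 0 < q"
proof (cases "q > 0")
  case True
  show ?thesis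
    by (rule that[OF stolarsky_tendsto_lim]) (use True assms stolarsky_lim_less_1 in auto)
next
  case False
  show ?thesis
    by (rule that[OF stolarsky_tendsto_0]) (use False assms in auto)
qed

section \<open>Comparison of orders and the entropy argument\<close>

lemma not_eventually_powr_bound:
  fixes f :: "real \<Rightarrow> real"
  assumes lim: "((\<lambda>y. f y / y powr s) \<longlongrightarrow> L) (at_right 0)" and "q < s"
    and ge: "\<forall>\<^sub>F y in at_right 0. f y \<ge> \<delta> * y powr q"
  shows "\<delta> \<le> 0"
proof (rule tendsto_lowerbound)
  show "((\<lambda>y. f y / y powr q) \<longlongrightarrow> 0) (at_right 0)"
    by (rule tendsto_divide_powr_smaller[OF lim \<open>q < s\<close>])
  show "\<forall>\<^sub>F y in at_right 0. \<delta> \<le> f y / y powr q"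
    using ge eventually_0_1 by eventually_elim (simp add: field_simps)
qed simp

text \<open>Logarithms of both equations add up to r ln r + (1 - r) ln (1 - r) = - ln 2, the
  equality case of Gibbs' inequality against the uniform distribution.\<close>

lemma entropy_contradiction:
  fixes r :: real
  assumes r: "0 < r" "r < 1"
    and e1: "(1 / (1 + r)) powr (1 / r) = r"
    and e2: "((1 + r) / 2) powr (1 / (1 - r)) = 1 - r"
  shows False
proof -
  have "ln ((1 / (1 + r)) powr (1 / r)) = - ln (1 + r) / r"
    using r by (simp add: ln_powr ln_div)
  with e1 r have 1: "r * ln r = - ln (1 + r)"
    by (simp add: field_simps)
  have "ln (1 - r) = ln (((1 + r) / 2) powr (1 / (1 - r)))"
    by (simp only: e2)
  also have "\<dots> = (ln (1 + r) - ln 2) / (1 - r)"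
    using r by (simp add: ln_powr ln_div)
  finally have "ln (1 - r) = (ln (1 + r) - ln 2) / (1 - r)" .
  with r have 2: "(1 - r) * ln (1 - r) = ln (1 + r) - ln 2"
    by simp
  have l: "ln (1 / (2 * u)) = - ln 2 - ln u" if "0 < u" for u :: real
    using that by (simp add: ln_div ln_mult)
  \<comment> \<open>The bound ln u \<le> u - 1 at u = 1/(2(1 - r)), weighted by
    \<open>1 - r\<close>.\<close>
  have "(1 - r) * ln (1 / (2 * (1 - r))) \<le> (1 - r) * (1 / (2 * (1 - r)) - 1)"
    using r by (intro mult_left_mono ln_le_minus_one) auto
  also have "\<dots> = r - 1 / 2"
    using r by (simp add: field_simps)
  finally have "(1 - r) * (- ln 2 - ln (1 - r)) \<le> r - 1 / 2"
    using l[of "1 - r"] r by (simp only: diff_gt_0_iff_gt)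
  \<comment> \<open>The two weighted logarithms sum to 0, so an upper bound for one is a lower bound
    for the other.\<close>
  with 1 2 have "r * (- ln 2 - ln r) \<ge> 1 / 2 - r"
    by (simp only: right_diff_distrib left_diff_distrib)
  moreover have "r * (1 / (2 * r) - 1) = 1 / 2 - r"
    using r by (simp add: field_simps)
  ultimately have "r * (1 / (2 * r) - 1) \<le> r * ln (1 / (2 * r))"
    using r by (simp add: l)
  then have "1 / (2 * r) - 1 \<le> ln (1 / (2 * r))"
    using r by simp
  with ln_le_minus_one[of "1 / (2 * r)"] r have "ln (1 / (2 * r)) = 1 / (2 * r) - 1"
    by simp
  from ln_eq_minus_one[OF _ this] r have r2: "r = 1 / 2"
    by simp
  have "(2 / 3 :: real) powr 2 = 1 / 2"
    using e1 unfolding r2 by simp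
  then show False
    by (simp add: power2_eq_square)
qed

section \<open>The equation at (1, y): comparison of coefficients\<close>

locale stolarsky_sum =
  fixes a b c d :: real
  assumes ba: "b \<le> a" and dc: "d \<le> c"
    and sum_eq: "\<And>y. 0 < y \<Longrightarrow> y < 1 \<Longrightarrow> stolarsky a b 1 y + stolarsky c d 1 y = 1 + y"
begin

abbreviation "e\<^sub>1 \<equiv> stolarsky_lim a b"
abbreviation "e\<^sub>2 \<equiv> stolarsky_lim c d"

lemma sum_tendsto_1: "((\<lambda>y. stolarsky a b 1 y + stolarsky c d 1 y) \<longlongrightarrow> 1) (at_right 0)"
proof (rule Lim_transform_eventually)
  show "((\<lambda>y::real. 1 + y) \<longlongrightarrow> 1) (at_right 0)"
    by real_asymp
  show "\<forall>\<^sub>F y in at_right 0. 1 + y = stolarsky a b 1 y + stolarsky c d 1 y"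
    using eventually_0_1 by eventually_elim (simp add: sum_eq)
qed

text \<open>Two limits below 1 with sum 1 are both positive.\<close>

lemma pos: "0 < b" "0 < d"
proof -
  obtain L where L: "(stolarsky a b 1 \<longlongrightarrow> L) (at_right 0)" "L < 1" "L > 0 \<longrightarrow> 0 < b"
    using stolarsky_tendsto_less_1[OF ba] .
  obtain M where M: "(stolarsky c d 1 \<longlongrightarrow> M) (at_right 0)" "M < 1" "M > 0 \<longrightarrow> 0 < d"
    using stolarsky_tendsto_less_1[OF dc] .
  have "L + M = 1"
    using sum_tendsto_1 tendsto_add[OF L(1) M(1)] tendsto_unique[OF trivial_limit_at_right_real] by blast
  with L M show "0 < b" "0 < d"
    by auto
qed

lemma lim_sum: "e\<^sub>1 + e\<^sub>2 = 1"
  using sum_tendsto_1 tendsto_add[OF stolarsky_tendsto_lim[OF pos(1) ba] stolarsky_tendsto_lim[OF pos(2) dc]]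
    tendsto_unique[OF trivial_limit_at_right_real] by blast

lemma rest_sum: "0 < y \<Longrightarrow> y < 1 \<Longrightarrow> (stolarsky a b 1 y - e\<^sub>1) + (stolarsky c d 1 y - e\<^sub>2) = y"
  using sum_eq[of y] lim_sum by simp

text \<open>Through this symmetry every fact about \<open>a\<close>, \<open>b\<close> is available
  for \<open>c\<close>, \<open>d\<close>.\<close>

lemma swap: "stolarsky_sum c d a b"
  by unfold_locales (use ba dc sum_eq in \<open>auto simp: add.commute\<close>)

text \<open>Both means eventually lie above their limits and the two excesses add up to y, so
  neither can be of larger order than y.\<close>

lemma b_ge_1: "b \<ge> 1"
proof (rule ccontr)
  assume "\<not> b \<ge> 1"
  obtain \<delta> where \<delta>: "\<delta> > 0" "\<forall>\<^sub>F y in at_right 0. stolarsky a b 1 y - e\<^sub>1 \<ge> \<delta> * y powr b"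
    using stolarsky_ge[OF pos(1) ba] .
  obtain \<epsilon> where \<epsilon>: "\<epsilon> > 0" "\<forall>\<^sub>F y in at_right 0. stolarsky c d 1 y - e\<^sub>2 \<ge> \<epsilon> * y powr d"
    using stolarsky_ge[OF pos(2) dc] .
  have "\<delta> \<le> 0"
  proof (rule not_eventually_powr_bound)
    show "((\<lambda>y::real. y / y powr 1) \<longlongrightarrow> 1) (at_right 0)"
      by real_asymp
    show "\<forall>\<^sub>F y in at_right 0. y \<ge> \<delta> * y powr b"
      using \<delta>(2) \<epsilon>(2) eventually_0_1
    proof eventually_elim
      case (elim y)
      have "0 \<le> \<epsilon> * y powr d"
        using \<epsilon>(1) by simp
      with elim rest_sum[of y] show ?case
        by linarith
    qed
  qed (use \<open>\<not> b \<ge> 1\<close> in simp)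
  with \<delta>(1) show False
    by simp
qed

text \<open>For \<open>a = b = 1\<close> the logarithm would make the first excess eventually larger
  than y, while the second is nonnegative.\<close>

lemma b_eq_1_imp_less:
  assumes "b = 1"
  shows "1 < a"
proof (rule ccontr)
  assume "\<not> 1 < a"
  with assms ba have [simp]: "a = 1" "b = 1"
    by auto
  obtain \<epsilon> where \<epsilon>: "\<epsilon> > 0" "\<forall>\<^sub>F y in at_right 0. stolarsky c d 1 y - e\<^sub>2 \<ge> \<epsilon> * y powr d"
    using stolarsky_ge[OF pos(2) dc] .
  have "\<forall>\<^sub>F y in at_right 0. (stolarsky 1 1 1 y - e\<^sub>1) / y powr 1 > 1"
    using stolarsky_expand1_diag[of 1] by (simp add: filterlim_at_top_dense)
  then have "\<forall>\<^sub>F y::real in at_right 0. False"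
    using \<epsilon>(2) eventually_0_1
  proof eventually_elim
    case (elim y)
    have "0 \<le> \<epsilon> * y powr d"
      using \<epsilon>(1) by simp
    with elim rest_sum[of y] show ?case
      by (simp add: field_simps)
  qed
  then show False
    by simp
qed

text \<open>Comparison of coefficients: \<open>u = v = 0\<close>, \<open>s = 1\<close> reads off the
  linear terms; \<open>u + v = 1\<close> removes them and exposes the next exponent.\<close>

lemma divided_sum:
  assumes "((\<lambda>y. (stolarsky a b 1 y - e\<^sub>1 - u * y) / y powr s) \<longlongrightarrow> L) (at_right 0)"
    and "((\<lambda>y. (stolarsky c d 1 y - e\<^sub>2 - v * y) / y powr s) \<longlongrightarrow> M) (at_right 0)"
    and "((\<lambda>y. (1 - u - v) * y / y powr s) \<longlongrightarrow> K) (at_right 0)"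
  shows "L + M = K"
proof -
  have "((\<lambda>y. (1 - u - v) * y / y powr s) \<longlongrightarrow> L + M) (at_right 0)"
  proof (rule Lim_transform_eventually[OF tendsto_add[OF assms(1,2)]])
    show "\<forall>\<^sub>F y in at_right 0. (stolarsky a b 1 y - e\<^sub>1 - u * y) / y powr s
      + (stolarsky c d 1 y - e\<^sub>2 - v * y) / y powr s = (1 - u - v) * y / y powr s"
      using eventually_0_1
    proof eventually_elim
      case (elim y)
      with rest_sum[of y] have "(stolarsky a b 1 y - e\<^sub>1 - u * y) + (stolarsky c d 1 y - e\<^sub>2 - v * y)
        = (1 - u - v) * y"
        by (simp add: algebra_simps)
      then show ?case
        by (metis add_divide_distrib)
    qed
  qed
  with assms(3) show ?thesis
    using tendsto_unique[OF trivial_limit_at_right_real] by blast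
qed

text \<open>Otherwise both excesses would be o(y), but their sum is y.\<close>

lemma b_or_d_eq_1: "b = 1 \<or> d = 1"
proof (rule ccontr)
  assume "\<not> ?thesis"
  with b_ge_1 stolarsky_sum.b_ge_1[OF swap] have "1 < b" "1 < d"
    by auto
  have "0 + 0 = (1 :: real)"
  proof (rule divided_sum[where u = 0 and v = 0 and s = 1])
    show "((\<lambda>y. (stolarsky a b 1 y - e\<^sub>1 - 0 * y) / y powr 1) \<longlongrightarrow> 0) (at_right 0)"
      using stolarsky_expand0[OF _ \<open>1 < b\<close> ba] by simp
    show "((\<lambda>y. (stolarsky c d 1 y - e\<^sub>2 - 0 * y) / y powr 1) \<longlongrightarrow> 0) (at_right 0)"
      using stolarsky_expand0[OF _ \<open>1 < d\<close> dc] by simp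
    show "((\<lambda>y::real. (1 - 0 - 0) * y / y powr 1) \<longlongrightarrow> 1) (at_right 0)"
      by real_asymp
  qed
  then show False
    by simp
qed

lemma both_1_coeff_sum:
  assumes "b = 1" "d = 1"
  shows "e\<^sub>1 / (a - 1) + e\<^sub>2 / (c - 1) = 1"
proof (rule divided_sum[where u = 0 and v = 0 and s = 1])
  show "((\<lambda>y. (stolarsky a b 1 y - e\<^sub>1 - 0 * y) / y powr 1) \<longlongrightarrow> e\<^sub>1 / (a - 1)) (at_right 0)"
    using stolarsky_expand1[of 1 a] b_eq_1_imp_less assms by simp
  show "((\<lambda>y. (stolarsky c d 1 y - e\<^sub>2 - 0 * y) / y powr 1) \<longlongrightarrow> e\<^sub>2 / (c - 1)) (at_right 0)"
    using stolarsky_expand1[of 1 c] stolarsky_sum.b_eq_1_imp_less[OF swap] assms by simp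
  show "((\<lambda>y::real. (1 - 0 - 0) * y / y powr 1) \<longlongrightarrow> 1) (at_right 0)"
    by real_asymp
qed

text \<open>If \<open>a < 2\<close>, the first mean has a negative term at y^a; since
  \<open>a \<le> c\<close>, the second has nothing positive there to cancel it.\<close>

lemma both_1_ge_2:
  assumes [simp]: "b = 1" "d = 1" and "a \<le> c"
  shows "2 \<le> a"
proof (rule ccontr)
  assume "\<not> 2 \<le> a"
  have a: "1 < a" and c: "1 < c"
    using b_eq_1_imp_less stolarsky_sum.b_eq_1_imp_less[OF swap] by auto
  define \<alpha> \<beta> where "\<alpha> = e\<^sub>1 / (a - 1)" and "\<beta> = e\<^sub>2 / (c - 1)"
  have sum: "\<alpha> + \<beta> = 1"
    using both_1_coeff_sum by (simp add: \<alpha>_def \<beta>_def)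
  have pos': "\<alpha> > 0" "\<beta> > 0"
    using a c by (simp_all add: \<alpha>_def \<beta>_def stolarsky_lim_pos)
  \<comment> \<open>The witness is -\<beta> if \<open>a = c\<close> and 0 if
    \<open>a < c\<close>.\<close>
  have "\<exists>M\<le>0. ((\<lambda>y. (stolarsky c d 1 y - e\<^sub>2 - \<beta> * y) / y powr a) \<longlongrightarrow> M) (at_right 0)"
  proof (cases "a = c")
    case True
    then show ?thesis
      using stolarsky_1_expand2[OF c] \<open>\<not> 2 \<le> a\<close> pos'
      by (intro exI[of _ "- \<beta>"]) (simp add: \<beta>_def)
  next
    case False
    then show ?thesis
      using stolarsky_1_expand2_smaller[OF c, of a] \<open>\<not> 2 \<le> a\<close> \<open>a \<le> c\<close>
      by (intro exI[of _ 0]) (simp add: \<beta>_def)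
  qed
  then obtain M where M: "M \<le> 0"
    "((\<lambda>y. (stolarsky c d 1 y - e\<^sub>2 - \<beta> * y) / y powr a) \<longlongrightarrow> M) (at_right 0)"
    by blast
  have "- \<alpha> + M = 0"
  proof (rule divided_sum[OF _ M(2)])
    show "((\<lambda>y. (stolarsky a b 1 y - e\<^sub>1 - \<alpha> * y) / y powr a) \<longlongrightarrow> - \<alpha>) (at_right 0)"
      using stolarsky_1_expand2[OF a] \<open>\<not> 2 \<le> a\<close> by (simp add: \<alpha>_def)
    show "((\<lambda>y. (1 - \<alpha> - \<beta>) * y / y powr a) \<longlongrightarrow> 0) (at_right 0)"
      using sum by (simp add: algebra_simps)
  qed
  with pos' M show False
    by simp
qed

lemma both_1:
  assumes [simp]: "b = 1" "d = 1"
  shows "a = 2 \<and> c = 2"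
proof -
  \<comment> \<open>The smaller of \<open>a\<close> and \<open>c\<close> is at least 2, hence both
    are.\<close>
  have "2 \<le> a" "2 \<le> c"
    using both_1_ge_2 stolarsky_sum.both_1_ge_2[OF swap] by fastforce+
  have pos': "e\<^sub>1 > 0" "e\<^sub>2 > 0"
    using \<open>2 \<le> a\<close> \<open>2 \<le> c\<close> by (auto intro: stolarsky_lim_pos)
  have *: "e / (p - 1) \<le> e" if "2 \<le> p" "0 < e" for e p :: real
    using that by (simp add: field_simps)
  \<comment> \<open>Termwise inequality between two sums that both equal 1 forces termwise
    equality.\<close>
  have "e\<^sub>1 / (a - 1) = e\<^sub>1" "e\<^sub>2 / (c - 1) = e\<^sub>2"
    using *[OF \<open>2 \<le> a\<close> pos'(1)] *[OF \<open>2 \<le> c\<close> pos'(2)] both_1_coeff_sum lim_sum by auto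
  with pos' \<open>2 \<le> a\<close> \<open>2 \<le> c\<close> show ?thesis
    by (simp add: field_simps)
qed

lemma not_1_less_d:
  assumes [simp]: "b = 1"
  shows "\<not> 1 < d"
proof
  assume d: "1 < d"
  have a: "1 < a"
    by (simp add: b_eq_1_imp_less)
  \<comment> \<open>With \<open>1 < d\<close> the second mean has no linear term.\<close>
  have "e\<^sub>1 / (a - 1) + 0 = 1"
  proof (rule divided_sum[where u = 0 and v = 0 and s = 1])
    show "((\<lambda>y. (stolarsky a b 1 y - e\<^sub>1 - 0 * y) / y powr 1) \<longlongrightarrow> e\<^sub>1 / (a - 1)) (at_right 0)"
      using stolarsky_expand1[of 1 a] a by simp
    show "((\<lambda>y. (stolarsky c d 1 y - e\<^sub>2 - 0 * y) / y powr 1) \<longlongrightarrow> 0) (at_right 0)"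
      using stolarsky_expand0[OF _ d dc] by simp
    show "((\<lambda>y::real. (1 - 0 - 0) * y / y powr 1) \<longlongrightarrow> 1) (at_right 0)"
      by real_asymp
  qed
  then have e1: "e\<^sub>1 = a - 1"
    using a by (simp add: field_simps)
  have "a < 2"
    using e1 stolarsky_lim_less_1[of b a] a by simp
  define g where "g y = stolarsky c d 1 y - e\<^sub>2" for y
  have f: "((\<lambda>y. (stolarsky a b 1 y - e\<^sub>1 - y) / y powr a) \<longlongrightarrow> - 1) (at_right 0)"
    using stolarsky_1_expand2[OF a \<open>a < 2\<close>] e1 a by simp
  \<comment> \<open>The first mean already supplies all of y, so \<open>g\<close> has to cancel its
    term -y^a.\<close>
  have g: "((\<lambda>y. g y / y powr a) \<longlongrightarrow> 1) (at_right 0)"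
  proof (rule Lim_transform_eventually)
    show "((\<lambda>y. - ((stolarsky a b 1 y - e\<^sub>1 - y) / y powr a)) \<longlongrightarrow> 1) (at_right 0)"
      using tendsto_minus[OF f] by simp
    show "\<forall>\<^sub>F y in at_right 0. - ((stolarsky a b 1 y - e\<^sub>1 - y) / y powr a) = g y / y powr a"
      using eventually_0_1
    proof eventually_elim
      case (elim y)
      with rest_sum[of y] have "g y = - (stolarsky a b 1 y - e\<^sub>1 - y)"
        by (simp add: g_def)
      then show ?case
        by (simp only: minus_divide_left)
    qed
  qed
  \<comment> \<open>The excess \<open>g\<close> is at least of order y^d, too large if
    \<open>d < a\<close>; for \<open>a < d\<close> it would be o(y^a).\<close>
  have "\<not> d < a"
  proof
    assume "d < a"
    obtain \<epsilon> where \<epsilon>: "\<epsilon> > 0" "\<forall>\<^sub>F y in at_right 0. g y \<ge> \<epsilon> * y powr d"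
      using stolarsky_ge[OF pos(2) dc] unfolding g_def .
    from not_eventually_powr_bound[OF g \<open>d < a\<close> \<epsilon>(2)] \<epsilon>(1) show False
      by simp
  qed
  moreover have "\<not> a < d"
  proof
    assume "a < d"
    from stolarsky_expand0[OF _ this dc] a have "((\<lambda>y. g y / y powr a) \<longlongrightarrow> 0) (at_right 0)"
      by (simp add: g_def)
    from tendsto_unique[OF trivial_limit_at_right_real g this] show False
      by simp
  qed
  ultimately have [simp]: "d = a"
    by simp
  have "c \<noteq> d"
  proof
    assume "c = d"
    then have "filterlim (\<lambda>y. g y / y powr a) at_top (at_right 0)"
      using stolarsky_expand1_diag[of a] a by (simp add: g_def)
    from not_tendsto_and_filterlim_at_infinity[OF trivial_limit_at_right_real g
        filterlim_at_top_imp_at_infinity[OF this]]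
    show False .
  qed
  with dc have "a < c"
    by simp
  have "((\<lambda>y. g y / y powr a) \<longlongrightarrow> e\<^sub>2 / (c - a)) (at_right 0)"
    using stolarsky_expand1[OF _ \<open>a < c\<close>] a by (simp add: g_def)
  from tendsto_unique[OF trivial_limit_at_right_real g this] have e2: "e\<^sub>2 = c - a"
    using \<open>a < c\<close> by (simp add: field_simps)
  \<comment> \<open>The limits a - 1 and c - a add up to 1.\<close>
  with e1 lim_sum have [simp]: "c = 2"
    by simp
  show False
  proof (rule entropy_contradiction)
    show "0 < a - 1" "a - 1 < 1"
      using a \<open>a < 2\<close> by auto
    show "(1 / (1 + (a - 1))) powr (1 / (a - 1)) = a - 1"
      using e1 a by (simp add: stolarsky_lim_def)
    show "((1 + (a - 1)) / 2) powr (1 / (1 - (a - 1))) = 1 - (a - 1)"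
      using e2 \<open>a < c\<close> by (simp add: stolarsky_lim_def)
  qed
qed

lemma all_eq: "a = 2 \<and> b = 1 \<and> c = 2 \<and> d = 1"
  using b_or_d_eq_1 not_1_less_d stolarsky_sum.not_1_less_d[OF swap] b_ge_1
    stolarsky_sum.b_ge_1[OF swap] both_1 by force

end

theorem corollaryS:
  fixes a b c d :: real
  shows "((\<forall>x>0. \<forall>y>0. stolarsky a b x y + stolarsky c d x y = x + y)
            \<longleftrightarrow> {a, b} = {c, d} \<and> {c, d} = {2, 1})
       \<and> ({a, b} = {c, d} \<and> {c, d} = {2, 1}
            \<longleftrightarrow> (\<forall>x>0. \<forall>y>0. stolarsky a b x y = (x + y) / 2
                          \<and> stolarsky c d x y = (x + y) / 2))"
proof -
  have param_eq: "{a, b} = {c, d} \<and> {c, d} = {2, 1}"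
    if "\<forall>x>0. \<forall>y>0. stolarsky a b x y + stolarsky c d x y = x + y"
  proof -
    \<comment> \<open>By symmetry each pair may be sorted; this leaves the sets unchanged.\<close>
    have "stolarsky_sum (max a b) (min a b) (max c d) (min c d)"
      by unfold_locales (use that in \<open>auto simp: stolarsky_max_min\<close>)
    from stolarsky_sum.all_eq[OF this] show ?thesis
      by (auto simp: max_def min_def split: if_splits)
  qed
  have mean: "stolarsky p q x y = (x + y) / 2" if "{p, q} = {2, 1}" "x > 0" "y > 0" for p q x y :: real
    using that stolarsky_2_1[of x y] stolarsky_commute[of 1 2 x y] by (auto simp: doubleton_eq_iff)
  have both: "\<forall>x>0. \<forall>y>0. stolarsky a b x y = (x + y) / 2 \<and> stolarsky c d x y = (x + y) / 2"
    if "{a, b} = {c, d} \<and> {c, d} = {2, 1}"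
  proof -
    have "{a, b} = {2, 1}" "{c, d} = {2, 1}"
      using that by (simp_all only:)
    then show ?thesis
      by (intro allI impI conjI mean)
  qed
  have sum: "\<forall>x>0. \<forall>y>0. stolarsky a b x y + stolarsky c d x y = x + y"
    if "\<forall>x>0. \<forall>y>0. stolarsky a b x y = (x + y) / 2 \<and> stolarsky c d x y = (x + y) / 2"
  proof (intro allI impI)
    fix x y :: real
    assume "x > 0" "y > 0"
    with that have "stolarsky a b x y = (x + y) / 2" "stolarsky c d x y = (x + y) / 2"
      by blast+
    then show "stolarsky a b x y + stolarsky c d x y = x + y"
      by (simp only: field_sum_of_halves)
  qed
  show ?thesis
    \<comment> \<open>The three implications form a cycle, which gives both equivalences.\<close>
    using param_eq both sum by argo
qed

end
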